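(* Let $\mathfrak g\xrightarrow{\mu}\mathfrak h$ be a crossed module of Lie algebras, $\phi:W\to V$ linear, $\rho$ a 2-representation on $\phi$, and $r\ge1$. Then, as maps $C^{p,q}_r(\mathfrak g_1,\phi)\to C^{p+1,q+1}_r(\mathfrak g_1,\phi)$, $$\delta^{(r)}\partial-\partial\delta^{(r)}=\delta_{(1)}\circ\Delta+\Delta\circ\delta_{(1)}.$$
   Context: Crossed module: Lie algebras $\mathfrak g,\mathfrak h$, Lie homomorphism $\mu$, action $\mathcal L:\mathfrak h\to\mathrm{Der}(\mathfrak g)$ with $\mu(\mathcal L_yx)=[y,\mu(x)]$, $\mathcal L_{\mu(x_0)}x_1=[x_0,x_1]$; $\mathfrak g\oplus_{\mathcal L}\mathfrak h$ has bracket $[(x_0,y_0),(x_1,y_1)]=([x_0,x_1]+\mathcal L_{y_0}x_1-\mathcal L_{y_1}x_0,[y_0,y_1])$. 2-representation: linear $\rho_0^1:\mathfrak h\to\mathfrak{gl}(W)$, $\rho_0^0:\mathfrak h\to\mathfrak{gl}(V)$, $\rho_1:\mathfrak g\to\mathrm{Hom}(V,W)$ with $\rho_0^1,\rho_0^0$ representations, $\phi\rho_0^1(y)=\rho_0^0(y)\phi$, $\rho_1([x_0,x_1])=\rho_1(x_0)\phi\rho_1(x_1)-\rho_1(x_1)\phi\rho_1(x_0)$, $\rho_0^0(\mu(x))=\phi\rho_1(x)$, $\rho_0^1(\mu(x))=\rho_1(x)\phi$, $\rho_1(\mathcal L_yx)=\rho_0^1(y)\rho_1(x)-\rho_1(x)\rho_0^0(y)$.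 $\mathfrak g_0=\mathfrak h$; for $p\ge1$, $\mathfrak g_p=\mathfrak g^p\oplus\mathfrak h$, elements $(x^0,\dots,x^{p-1};y)$, a Lie algebra via identification with composable strings $(a_0,\dots,a_{p-1})\in(\mathfrak g\oplus_{\mathcal L}\mathfrak h)^p$, $a_j=(x^j,y+\sum_{k>j}\mu(x^k))$, componentwise bracket. Face maps $\partial_k:\mathfrak g_{p+1}\to\mathfrak g_p$: $\partial_0(x^0,\dots,x^p;y)=(x^1,\dots,x^p;y)$, $\partial_k(\dots)=(x^0,\dots,x^{k-1}+x^k,\dots,x^p;y)$ ($0<k\le p$), $\partial_{p+1}(\dots)=(x^0,\dots,x^{p-1};y+\mu(x^p))$, componentwise on tuples; $\hat t_p(x^0,\dots,x^{p-1};y)=y+\sum\mu(x^j)$. $X(j),X(m,n)$: removal of entries. $C^{p,q}_r=\bigwedge^q\mathfrak g_p^*\otimes\bigwedge^r\mathfrak g^*\otimes W$ ($r\ge1$), $C^{p,q}_0=\bigwedge^q\mathfrak g_p^*\otimes V$, elements $\omega(\Xi;Z)$. $\delta^{(r)}\omega(\xi_0,\dots,\xi_q;Z)=\sum_j(-1)^j(\rho^{(r)}(\hat t_p(\xi_j))\omega(\Xi(j);\cdot))(Z)+\sum_{m<n}(-1)^{m+n}\omega([\xi_m,\xi_n],\Xi(m,n);Z)$, $(\rho^{(r)}(y)\beta)(x_1,\dots,x_r)=\rho_0^1(y)\beta(x_1,\dots,x_r)-\sum_k\beta(x_1,\dots,\mathcal L_yx_k,\dots,x_r)$ ($r\ge1$),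 $\rho^{(0)}=\rho_0^0$. $\partial\omega(\Xi;Z)=\sum_{k=0}^{p+1}(-1)^k\omega(\partial_k\Xi;Z)$. $\delta_{(1)}:C^{p,q}_r\to C^{p,q}_{r+1}$: for $r=0$, $\delta_{(1)}\omega(\Xi;x)=\rho_1(x)\omega(\Xi)$; for $r\ge1$, $\delta_{(1)}\omega(\Xi;z_0,\dots,z_r)=\sum_k(-1)^k\rho_0^1(\mu(z_k))\omega(\Xi;Z(k))+\sum_{a<b}(-1)^{a+b}\omega(\Xi;[z_a,z_b],Z(a,b))$. $\Delta:C^{p,q}_r\to C^{p+1,q+1}_{r-1}$ ($r\ge1$): for $\Xi=(\xi_0,\dots,\xi_q)\in\mathfrak g_{p+1}^{q+1}$, $\xi_j=(x_j^0,\dots,x_j^p;y_j)$, $\Delta\omega(\Xi;Z)=\sum_j(-1)^j\omega(\partial_0\Xi(j);x_j^0,Z)$, composed with $\phi$ when $r=1$. *)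

theory Defs
  imports Complex_Main
begin

text \<open>All vector spaces are real vector spaces. Elements of g_p are pairs (xs, y) with
  xs a list of length p of elements of g and y in h.  Cochains in C^{p,q}_r (r >= 1) are
  functions of a list Xi of q elements of g_p and a list Z of r elements of g, with values in W.\<close>

definition lie_algebra :: "('a::real_vector \<Rightarrow> 'a \<Rightarrow> 'a) \<Rightarrow> bool" where
  "lie_algebra br \<longleftrightarrow> (\<forall>x. linear (br x)) \<and> (\<forall>y. linear (\<lambda>x. br x y)) \<and>
     (\<forall>x. br x x = 0) \<and> (\<forall>x y z. br x (br y z) + br y (br z x) + br z (br x y) = 0)"

definition lie_hom :: "('a::real_vector \<Rightarrow> 'a \<Rightarrow> 'a) \<Rightarrow> ('b::real_vector \<Rightarrow> 'b \<Rightarrow> 'b) \<Rightarrow> ('a \<Rightarrow> 'b) \<Rightarrow> bool" where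
  "lie_hom ba bb f \<longleftrightarrow> linear f \<and> (\<forall>x y. f (ba x y) = bb (f x) (f y))"

definition derivation :: "('a::real_vector \<Rightarrow> 'a \<Rightarrow> 'a) \<Rightarrow> ('a \<Rightarrow> 'a) \<Rightarrow> bool" where
  "derivation br D \<longleftrightarrow> linear D \<and> (\<forall>x y. D (br x y) = br (D x) y + br x (D y))"

text \<open>Crossed module: mu a Lie algebra morphism, L a Lie algebra morphism h -> Der(g),
  equivariance and Peiffer identity.\<close>
definition crossed_module ::
  "('g::real_vector \<Rightarrow> 'g \<Rightarrow> 'g) \<Rightarrow> ('h::real_vector \<Rightarrow> 'h \<Rightarrow> 'h) \<Rightarrow> ('g \<Rightarrow> 'h) \<Rightarrow> ('h \<Rightarrow> 'g \<Rightarrow> 'g) \<Rightarrow> bool" where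
  "crossed_module bg bh mu L \<longleftrightarrow> lie_algebra bg \<and> lie_algebra bh \<and> lie_hom bg bh mu \<and>
     (\<forall>x. linear (\<lambda>y. L y x)) \<and> (\<forall>y. derivation bg (L y)) \<and>
     (\<forall>y1 y2 x. L (bh y1 y2) x = L y1 (L y2 x) - L y2 (L y1 x)) \<and>
     (\<forall>y x. mu (L y x) = bh y (mu x)) \<and>
     (\<forall>x0 x1. L (mu x0) x1 = bg x0 x1)"

definition representation :: "('h::real_vector \<Rightarrow> 'h \<Rightarrow> 'h) \<Rightarrow> ('h \<Rightarrow> 'w::real_vector \<Rightarrow> 'w) \<Rightarrow> bool" where
  "representation bh rho \<longleftrightarrow> (\<forall>y. linear (rho y)) \<and> (\<forall>w. linear (\<lambda>y. rho y w)) \<and>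
     (\<forall>y1 y2 w. rho (bh y1 y2) w = rho y1 (rho y2 w) - rho y2 (rho y1 w))"

definition two_rep ::
  "('g::real_vector \<Rightarrow> 'g \<Rightarrow> 'g) \<Rightarrow> ('h::real_vector \<Rightarrow> 'h \<Rightarrow> 'h) \<Rightarrow> ('g \<Rightarrow> 'h) \<Rightarrow> ('h \<Rightarrow> 'g \<Rightarrow> 'g) \<Rightarrow>
   ('w::real_vector \<Rightarrow> 'v::real_vector) \<Rightarrow> ('h \<Rightarrow> 'w \<Rightarrow> 'w) \<Rightarrow> ('h \<Rightarrow> 'v \<Rightarrow> 'v) \<Rightarrow> ('g \<Rightarrow> 'v \<Rightarrow> 'w) \<Rightarrow> bool" where
  "two_rep bg bh mu L phi rho01 rho00 rho1 \<longleftrightarrow>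
     linear phi \<and> representation bh rho01 \<and> representation bh rho00 \<and>
     (\<forall>x. linear (rho1 x)) \<and> (\<forall>v. linear (\<lambda>x. rho1 x v)) \<and>
     (\<forall>y w. phi (rho01 y w) = rho00 y (phi w)) \<and>
     (\<forall>x0 x1 v. rho1 (bg x0 x1) v = rho1 x0 (phi (rho1 x1 v)) - rho1 x1 (phi (rho1 x0 v))) \<and>
     (\<forall>x v. rho00 (mu x) v = phi (rho1 x v)) \<and>
     (\<forall>x w. rho01 (mu x) w = rho1 x (phi w)) \<and>
     (\<forall>y x v. rho1 (L y x) v = rho01 y (rho1 x v) - rho1 x (rho00 y v))"

subsection \<open>The Lie algebras g_p\<close>

definition gp_dom :: "nat \<Rightarrow> ('g list \<times> 'h) \<Rightarrow> bool" where
  "gp_dom p \<xi> \<longleftrightarrow> length (fst \<xi>) = p"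

definition gp_add :: "('g::real_vector list \<times> 'h::real_vector) \<Rightarrow> ('g list \<times> 'h) \<Rightarrow> ('g list \<times> 'h)" where
  "gp_add a b = (map (\<lambda>(u, v). u + v) (zip (fst a) (fst b)), snd a + snd b)"

definition gp_scale :: "real \<Rightarrow> ('g::real_vector list \<times> 'h::real_vector) \<Rightarrow> ('g list \<times> 'h)" where
  "gp_scale c a = (map (\<lambda>u. c *\<^sub>R u) (fst a), c *\<^sub>R snd a)"

text \<open>h-component of the j-th arrow of the composable string: y + sum_{k>j} mu(x^k).\<close>
definition tgt_h :: "('g \<Rightarrow> 'h::monoid_add) \<Rightarrow> ('g list \<times> 'h) \<Rightarrow> nat \<Rightarrow> 'h" where
  "tgt_h mu \<xi> j = snd \<xi> + sum_list (map mu (drop (Suc j) (fst \<xi>)))"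

text \<open>Bracket on g_p, componentwise bracket of g semidirect h on composable strings.\<close>
definition gp_bracket ::
  "('g::real_vector \<Rightarrow> 'g \<Rightarrow> 'g) \<Rightarrow> ('h::real_vector \<Rightarrow> 'h \<Rightarrow> 'h) \<Rightarrow> ('g \<Rightarrow> 'h) \<Rightarrow> ('h \<Rightarrow> 'g \<Rightarrow> 'g) \<Rightarrow>
   ('g list \<times> 'h) \<Rightarrow> ('g list \<times> 'h) \<Rightarrow> ('g list \<times> 'h)" where
  "gp_bracket bg bh mu L a b =
     (map (\<lambda>j. bg (fst a ! j) (fst b ! j) + L (tgt_h mu a j) (fst b ! j) - L (tgt_h mu b j) (fst a ! j))
          [0..<length (fst a)],
      bh (snd a) (snd b))"

definition t_hat :: "('g \<Rightarrow> 'h::monoid_add) \<Rightarrow> ('g list \<times> 'h) \<Rightarrow> 'h" where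
  "t_hat mu \<xi> = snd \<xi> + sum_list (map mu (fst \<xi>))"

text \<open>Face maps g_{p+1} -> g_p, for an element whose list has length p+1.\<close>
definition face :: "('g::real_vector \<Rightarrow> 'h::real_vector) \<Rightarrow> nat \<Rightarrow> ('g list \<times> 'h) \<Rightarrow> ('g list \<times> 'h)" where
  "face mu k \<xi> =
     (if k = 0 then (tl (fst \<xi>), snd \<xi>)
      else if k < length (fst \<xi>) then
        (take (k - 1) (fst \<xi>) @ [fst \<xi> ! (k - 1) + fst \<xi> ! k] @ drop (Suc k) (fst \<xi>), snd \<xi>)
      else (butlast (fst \<xi>), snd \<xi> + mu (last (fst \<xi>))))"

text \<open>Removal of entries: X(j) and X(m,n) (m < n).\<close>
definition rem1 :: "nat \<Rightarrow> 'a list \<Rightarrow> 'a list" where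
  "rem1 j xs = take j xs @ drop (Suc j) xs"

definition rem2 :: "nat \<Rightarrow> nat \<Rightarrow> 'a list \<Rightarrow> 'a list" where
  "rem2 m n xs = rem1 m (rem1 n xs)"

subsection \<open>Cochains\<close>

definition alt_multilinear ::
  "('a \<Rightarrow> bool) \<Rightarrow> ('a \<Rightarrow> 'a \<Rightarrow> 'a) \<Rightarrow> (real \<Rightarrow> 'a \<Rightarrow> 'a) \<Rightarrow> nat \<Rightarrow> ('a list \<Rightarrow> 'b::real_vector) \<Rightarrow> bool" where
  "alt_multilinear D add sc n f \<longleftrightarrow>
     (\<forall>xs i a b c. length xs = n \<and> (\<forall>x\<in>set xs. D x) \<and> i < n \<and> D a \<and> D b \<longrightarrow>
        f (xs[i := add a b]) = f (xs[i := a]) + f (xs[i := b]) \<and>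
        f (xs[i := sc c a]) = c *\<^sub>R f (xs[i := a])) \<and>
     (\<forall>xs i j. length xs = n \<and> (\<forall>x\<in>set xs. D x) \<and> i < j \<and> j < n \<and> xs ! i = xs ! j \<longrightarrow> f xs = 0)"

text \<open>omega in C^{p,q}_r = Alt^q g_p^* (x) Alt^r g^* (x) W, for r >= 1.\<close>
definition cochain :: "nat \<Rightarrow> nat \<Rightarrow> nat \<Rightarrow> (('g::real_vector list \<times> 'h::real_vector) list \<Rightarrow> 'g list \<Rightarrow> 'w::real_vector) \<Rightarrow> bool" where
  "cochain p q r \<omega> \<longleftrightarrow>
     (\<forall>Z. length Z = r \<longrightarrow> alt_multilinear (gp_dom p) gp_add gp_scale q (\<lambda>\<Xi>. \<omega> \<Xi> Z)) \<and>
     (\<forall>\<Xi>. length \<Xi> = q \<and> (\<forall>\<xi>\<in>set \<Xi>. gp_dom p \<xi>) \<longrightarrow>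
        alt_multilinear (\<lambda>_. True) (+) (*\<^sub>R) r (\<omega> \<Xi>))"

subsection \<open>Operators\<close>

definition rho_r :: "('h \<Rightarrow> 'w \<Rightarrow> 'w::real_vector) \<Rightarrow> ('h \<Rightarrow> 'g \<Rightarrow> 'g) \<Rightarrow> 'h \<Rightarrow> ('g list \<Rightarrow> 'w) \<Rightarrow> 'g list \<Rightarrow> 'w" where
  "rho_r rho01 L y \<beta> Z = rho01 y (\<beta> Z) - (\<Sum>k<length Z. \<beta> (Z[k := L y (Z ! k)]))"

definition delta_r ::
  "('g::real_vector \<Rightarrow> 'g \<Rightarrow> 'g) \<Rightarrow> ('h::real_vector \<Rightarrow> 'h \<Rightarrow> 'h) \<Rightarrow> ('g \<Rightarrow> 'h) \<Rightarrow> ('h \<Rightarrow> 'g \<Rightarrow> 'g) \<Rightarrow>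
   ('h \<Rightarrow> 'w \<Rightarrow> 'w::real_vector) \<Rightarrow> (('g list \<times> 'h) list \<Rightarrow> 'g list \<Rightarrow> 'w) \<Rightarrow> (('g list \<times> 'h) list \<Rightarrow> 'g list \<Rightarrow> 'w)" where
  "delta_r bg bh mu L rho01 \<omega> \<Xi> Z =
     (\<Sum>j<length \<Xi>. (-1::real) ^ j *\<^sub>R rho_r rho01 L (t_hat mu (\<Xi> ! j)) (\<omega> (rem1 j \<Xi>)) Z) +
     (\<Sum>n<length \<Xi>. \<Sum>m<n. (-1::real) ^ (m + n) *\<^sub>R
        \<omega> (gp_bracket bg bh mu L (\<Xi> ! m) (\<Xi> ! n) # rem2 m n \<Xi>) Z)"

text \<open>Simplicial differential C^{p,q}_r -> C^{p+1,q}_r.\<close>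
definition pd :: "('g::real_vector \<Rightarrow> 'h::real_vector) \<Rightarrow> nat \<Rightarrow> (('g list \<times> 'h) list \<Rightarrow> 'g list \<Rightarrow> 'w::real_vector) \<Rightarrow>
   (('g list \<times> 'h) list \<Rightarrow> 'g list \<Rightarrow> 'w)" where
  "pd mu p \<omega> \<Xi> Z = (\<Sum>k\<le>Suc p. (-1::real) ^ k *\<^sub>R \<omega> (map (face mu k) \<Xi>) Z)"

text \<open>delta_(1) on C_0 (V-valued) and on C_r, r >= 1 (W-valued).\<close>
definition delta1_0 :: "('g \<Rightarrow> 'v \<Rightarrow> 'w) \<Rightarrow> (('g list \<times> 'h) list \<Rightarrow> 'v) \<Rightarrow> (('g list \<times> 'h) list \<Rightarrow> 'g list \<Rightarrow> 'w)" where
  "delta1_0 rho1 \<nu> \<Xi> Z = rho1 (hd Z) (\<nu> \<Xi>)"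

definition delta1 :: "('g \<Rightarrow> 'g \<Rightarrow> 'g) \<Rightarrow> ('g \<Rightarrow> 'h) \<Rightarrow> ('h \<Rightarrow> 'w \<Rightarrow> 'w::real_vector) \<Rightarrow>
   (('g list \<times> 'h) list \<Rightarrow> 'g list \<Rightarrow> 'w) \<Rightarrow> (('g list \<times> 'h) list \<Rightarrow> 'g list \<Rightarrow> 'w)" where
  "delta1 bg mu rho01 \<omega> \<Xi> Z =
     (\<Sum>k<length Z. (-1::real) ^ k *\<^sub>R rho01 (mu (Z ! k)) (\<omega> \<Xi> (rem1 k Z))) +
     (\<Sum>b<length Z. \<Sum>a<b. (-1::real) ^ (a + b) *\<^sub>R \<omega> \<Xi> (bg (Z ! a) (Z ! b) # rem2 a b Z))"

text \<open>Delta : C^{p,q}_r -> C^{p+1,q+1}_{r-1}; for r >= 2 (W-valued result) and for r = 1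
  (composed with phi, V-valued result).\<close>
definition Delta :: "('g::real_vector \<Rightarrow> 'h::real_vector) \<Rightarrow> (('g list \<times> 'h) list \<Rightarrow> 'g list \<Rightarrow> 'w::real_vector) \<Rightarrow>
   (('g list \<times> 'h) list \<Rightarrow> 'g list \<Rightarrow> 'w)" where
  "Delta mu \<omega> \<Xi> Z = (\<Sum>j<length \<Xi>. (-1::real) ^ j *\<^sub>R \<omega> (map (face mu 0) (rem1 j \<Xi>)) (hd (fst (\<Xi> ! j)) # Z))"

definition Delta_1 :: "('g::real_vector \<Rightarrow> 'h::real_vector) \<Rightarrow> ('w::real_vector \<Rightarrow> 'v::real_vector) \<Rightarrow>
   (('g list \<times> 'h) list \<Rightarrow> 'g list \<Rightarrow> 'w) \<Rightarrow> (('g list \<times> 'h) list \<Rightarrow> 'v)" where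
  "Delta_1 mu phi \<omega> \<Xi> = (\<Sum>j<length \<Xi>. (-1::real) ^ j *\<^sub>R phi (\<omega> (map (face mu 0) (rem1 j \<Xi>)) [hd (fst (\<Xi> ! j))]))"

end

theory Submission
  imports Defs
begin

text \<open>
  Write \<delta>^(r) = \<delta>_act + \<delta>_br, the sum over single entries acting through \<rho>^(r)(t \<xi>_j) and
  the sum over brackets. The faces g_(p+1) \<rightarrow> g_p are Lie algebra morphisms, because merging two
  composable arrows of g \<oplus>_L h, and the target map (x, y) \<mapsto> y + \<mu> x, are compatible with the
  bracket; hence \<partial> commutes with \<delta>_br. The faces \<partial>_k with k \<ge> 1 preserve t, whereas
  t (\<partial>_0 \<xi>) = t \<xi> - \<mu> x^0, so \<delta>_act \<partial> - \<partial> \<delta>_act = \<Sum>_j (-1)^j \<rho>^(r)(\<mu> x_j^0) \<omega>(\<partial>_0 \<Xi>(j)).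
  The Peiffer identity L_(\<mu> x) = [x, -] gives Cartan's formula \<rho>^(r)(\<mu> x) = \<delta>_(1) \<iota>_x + \<iota>_x \<delta>_(1),
  where \<iota>_x inserts x as first argument; summed over j, the two terms become \<delta>_(1) \<Delta> \<omega> and
  \<Delta> \<delta>_(1) \<omega>. For r = 1, \<rho>_0^1(\<mu> z) = \<rho>_1(z) \<phi> identifies \<delta>_(1) \<Delta> \<omega> with \<delta>_(1) of the V-valued \<Delta> \<omega>.
\<close>

lemma lie_algebra_add_left: "lie_algebra br \<Longrightarrow> br (a + b) c = br a c + br b c"
  unfolding lie_algebra_def by (metis linear_add)

lemma lie_algebra_add_right: "lie_algebra br \<Longrightarrow> br a (b + c) = br a b + br a c"
  unfolding lie_algebra_def by (metis linear_add)

lemma lie_algebra_anticomm: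
  assumes "lie_algebra br"
  shows "br a b = - br b a"
proof -
  have alt: "br x x = 0" for x
    using assms by (simp add: lie_algebra_def)
  have "0 = br (a + b) (a + b)"
    by (simp add: alt)
  also have "\<dots> = br a a + br b a + (br a b + br b b)"
    by (simp only: lie_algebra_add_left[OF assms] lie_algebra_add_right[OF assms])
  also have "\<dots> = br a b + br b a"
    by (simp add: alt add.commute)
  finally have "br a b + br b a = 0"
    by (rule sym)
  then show ?thesis
    by (simp add: eq_neg_iff_add_eq_0)
qed

lemma face_0_Cons [simp]: "face mu 0 (x # xs, y) = (xs, y)"
  by (simp add: face_def)

lemma face_Suc_singleton [simp]: "face mu (Suc k) ([x], y) = ([], y + mu x)"
  by (simp add: face_def)

lemma face_1_Cons_Cons [simp]: "face mu (Suc 0) (x # x' # xs, y) = ((x + x') # xs, y)"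
  by (simp add: face_def)

lemma face_Suc_Suc_Cons_Cons [simp]:
  "face mu (Suc (Suc k)) (x # x' # xs, y) =
     (x # fst (face mu (Suc k) (x' # xs, y)), snd (face mu (Suc k) (x' # xs, y)))"
  by (simp add: face_def nth_Cons')

lemma length_face: "length (fst \<xi>) = Suc p \<Longrightarrow> length (fst (face mu k \<xi>)) = p"
  by (auto simp: face_def)

lemma t_hat_Cons:
  fixes mu :: "'g \<Rightarrow> 'h::comm_monoid_add"
  shows "t_hat mu (x # xs, y) = t_hat mu (xs, y) + mu x"
  by (simp add: t_hat_def algebra_simps)

lemma t_hat_face:
  assumes "linear mu" and "xs \<noteq> []"
  shows "t_hat mu (face mu (Suc k) (xs, y)) = t_hat mu (xs, y)"
  using assms(2)
proof (induction xs arbitrary: k)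
  case (Cons x xs)
  show ?case
  proof (cases "xs = []")
    case True
    then show ?thesis
      by (simp add: t_hat_def)
  next
    case False
    then obtain x' xs' where "xs = x' # xs'"
      by (cases xs) auto
    with Cons.IH False show ?thesis
      by (cases k) (simp_all add: t_hat_Cons linear_add[OF assms(1)] add.assoc)
  qed
qed simp

lemma gp_bracket_Nil [simp]: "gp_bracket bg bh mu L ([], y) ([], y') = ([], bh y y')"
  by (simp add: gp_bracket_def)

lemma snd_gp_bracket [simp]: "snd (gp_bracket bg bh mu L a b) = bh (snd a) (snd b)"
  by (simp add: gp_bracket_def)

lemma gp_bracket_Cons:
  "length xs = length xs' \<Longrightarrow>
   gp_bracket bg bh mu L (x # xs, y) (x' # xs', y') =
     ((bg x x' + L (t_hat mu (xs, y)) x' - L (t_hat mu (xs', y')) x)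
        # fst (gp_bracket bg bh mu L (xs, y) (xs', y')),
      bh y y')"
  by (simp add: gp_bracket_def tgt_h_def t_hat_def upt_conv_Cons map_Suc_upt[symmetric] del: upt_Suc)

lemma rem1_map: "rem1 j (map f xs) = map f (rem1 j xs)"
  by (simp add: rem1_def take_map drop_map)

lemma rem2_map: "rem2 m n (map f xs) = map f (rem2 m n xs)"
  by (simp add: rem2_def rem1_map)

lemma length_rem1: "j < length xs \<Longrightarrow> length (rem1 j xs) = length xs - 1"
  by (simp add: rem1_def)

lemma length_rem2: "m < n \<Longrightarrow> n < length xs \<Longrightarrow> length (rem2 m n xs) = length xs - 2"
  by (simp add: rem2_def length_rem1)

lemma set_rem1_subset: "set (rem1 j xs) \<subseteq> set xs"
  unfolding rem1_def using set_take_subset set_drop_subset by fastforce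

lemma rem1_Cons_0 [simp]: "rem1 0 (x # xs) = xs"
  by (simp add: rem1_def)

lemma rem1_Cons_Suc [simp]: "rem1 (Suc k) (x # xs) = x # rem1 k xs"
  by (simp add: rem1_def)

lemma rem2_Cons_0 [simp]: "rem2 0 (Suc n) (x # xs) = rem1 n xs"
  by (simp add: rem2_def rem1_def)

lemma rem2_Cons_Suc [simp]: "rem2 (Suc m) (Suc n) (x # xs) = x # rem2 m n xs"
  by (simp add: rem2_def)

context
  fixes f :: "'a::real_vector list \<Rightarrow> 'b::real_vector" and n :: nat
  assumes alt: "alt_multilinear (\<lambda>_. True) (+) (*\<^sub>R) n f"
begin

lemma alt_multilinear_add:
  "length xs = n \<Longrightarrow> i < n \<Longrightarrow> f (xs[i := a + b]) = f (xs[i := a]) + f (xs[i := b])"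
  using alt unfolding alt_multilinear_def by blast

lemma alt_multilinear_eq_0:
  "length xs = n \<Longrightarrow> i < j \<Longrightarrow> j < n \<Longrightarrow> xs ! i = xs ! j \<Longrightarrow> f xs = 0"
  using alt unfolding alt_multilinear_def by blast

lemma alt_multilinear_swap:
  assumes len: "length (xs @ a # b # ys) = n"
  shows "f (xs @ a # b # ys) = - f (xs @ b # a # ys)"
proof -
  let ?i = "length xs"
  have upd: "(xs @ u # v # ys)[?i := w] = xs @ w # v # ys"
            "(xs @ u # v # ys)[Suc ?i := w] = xs @ u # w # ys" for u v w
    by (simp_all add: list_update_append)
  have diag: "f (xs @ u # u # ys) = 0" for u
    using alt_multilinear_eq_0[of "xs @ u # u # ys" ?i "Suc ?i"] len by (simp add: nth_append)
  have add1: "f (xs @ (a + b) # w # ys) = f (xs @ a # w # ys) + f (xs @ b # w # ys)" for w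
    using alt_multilinear_add[of "xs @ a # w # ys" ?i a b] len by (simp add: upd)
  have add2: "f (xs @ u # (a + b) # ys) = f (xs @ u # a # ys) + f (xs @ u # b # ys)" for u
    using alt_multilinear_add[of "xs @ u # a # ys" "Suc ?i" a b] len by (simp add: upd)
  have "0 = f (xs @ a # b # ys) + f (xs @ b # a # ys)"
    using diag[of "a + b"] add1 add2 diag[of a] diag[of b] by (simp add: add.commute)
  then show ?thesis
    by (simp add: eq_neg_iff_add_eq_0)
qed

lemma alt_multilinear_move_to_front:
  "length (xs @ w # ys) = n \<Longrightarrow> f (xs @ w # ys) = (-1::real) ^ length xs *\<^sub>R f (w # xs @ ys)"
proof (induction xs arbitrary: ys rule: rev_induct)
  case (snoc x xs)
  have "f ((xs @ [x]) @ w # ys) = - f (xs @ w # x # ys)"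
    using alt_multilinear_swap[of xs x w ys] snoc.prems by simp
  also have "\<dots> = - ((-1::real) ^ length xs *\<^sub>R f (w # xs @ x # ys))"
    using snoc.IH[of "x # ys"] snoc.prems by simp
  finally show ?case
    by simp
qed simp

end

lemma cochain_alt_multilinear_face_rem1:
  assumes "cochain p q r \<omega>" and "length \<Xi> = Suc q" and "\<forall>\<xi>\<in>set \<Xi>. length (fst \<xi>) = Suc p"
    and "j < length \<Xi>"
  shows "alt_multilinear (\<lambda>_. True) (+) (*\<^sub>R) r (\<omega> (map (face mu k) (rem1 j \<Xi>)))"
proof -
  have "length (map (face mu k) (rem1 j \<Xi>)) = q"
    using assms(2,4) by (simp add: length_rem1)
  moreover have "\<forall>\<xi>\<in>set (map (face mu k) (rem1 j \<Xi>)). gp_dom p \<xi>"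
    using assms(3) set_rem1_subset[of j \<Xi>] by (auto simp: gp_dom_def intro!: length_face)
  ultimately show ?thesis
    using assms(1) by (simp add: cochain_def)
qed

definition delta_action ::
  "('g \<Rightarrow> 'h::monoid_add) \<Rightarrow> ('h \<Rightarrow> 'g \<Rightarrow> 'g) \<Rightarrow> ('h \<Rightarrow> 'w \<Rightarrow> 'w::real_vector) \<Rightarrow>
   (('g list \<times> 'h) list \<Rightarrow> 'g list \<Rightarrow> 'w) \<Rightarrow> ('g list \<times> 'h) list \<Rightarrow> 'g list \<Rightarrow> 'w" where
  "delta_action mu L rho01 \<omega> \<Xi> Z =
     (\<Sum>j<length \<Xi>. (-1::real) ^ j *\<^sub>R rho_r rho01 L (t_hat mu (\<Xi> ! j)) (\<omega> (rem1 j \<Xi>)) Z)"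

definition delta_bracket ::
  "('g::real_vector \<Rightarrow> 'g \<Rightarrow> 'g) \<Rightarrow> ('h::real_vector \<Rightarrow> 'h \<Rightarrow> 'h) \<Rightarrow> ('g \<Rightarrow> 'h) \<Rightarrow> ('h \<Rightarrow> 'g \<Rightarrow> 'g) \<Rightarrow>
   (('g list \<times> 'h) list \<Rightarrow> 'g list \<Rightarrow> 'w::real_vector) \<Rightarrow> ('g list \<times> 'h) list \<Rightarrow> 'g list \<Rightarrow> 'w" where
  "delta_bracket bg bh mu L \<omega> \<Xi> Z =
     (\<Sum>n<length \<Xi>. \<Sum>m<n. (-1::real) ^ (m + n) *\<^sub>R
        \<omega> (gp_bracket bg bh mu L (\<Xi> ! m) (\<Xi> ! n) # rem2 m n \<Xi>) Z)"

lemma delta_r_eq_action_plus_bracket: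
  "delta_r bg bh mu L rho01 \<omega> =
     (\<lambda>\<Xi> Z. delta_action mu L rho01 \<omega> \<Xi> Z + delta_bracket bg bh mu L \<omega> \<Xi> Z)"
  by (intro ext) (simp add: delta_r_def delta_action_def delta_bracket_def)

lemma pd_add: "pd mu p (\<lambda>\<Xi> Z. f \<Xi> Z + g \<Xi> Z) \<Xi> Z = pd mu p f \<Xi> Z + pd mu p g \<Xi> Z"
  by (simp add: pd_def scaleR_right_distrib sum.distrib)

lemma rho_r_pd:
  assumes "linear (rho01 y)"
  shows "rho_r rho01 L y (pd mu p \<omega> X) Z =
    (\<Sum>k\<le>Suc p. (-1::real) ^ k *\<^sub>R rho_r rho01 L y (\<omega> (map (face mu k) X)) Z)"
  unfolding rho_r_def pd_def
  by (simp add: linear_sum[OF assms] linear_cmul[OF assms] scaleR_right_diff_distrib sum_subtractf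
      scaleR_right.sum sum.swap[of _ "{..Suc p}"] del: sum.atMost_Suc)

lemma rho_r_add:
  assumes "linear (\<lambda>y. rho01 y (\<beta> Z))" and "\<And>x. linear (\<lambda>y. L y x)"
    and "alt_multilinear (\<lambda>_. True) (+) (*\<^sub>R) (length Z) \<beta>"
  shows "rho_r rho01 L (y + d) \<beta> Z = rho_r rho01 L y \<beta> Z + rho_r rho01 L d \<beta> Z"
proof -
  have "\<beta> (Z[k := L (y + d) (Z ! k)]) = \<beta> (Z[k := L y (Z ! k)]) + \<beta> (Z[k := L d (Z ! k)])"
    if "k < length Z" for k
    using alt_multilinear_add[OF assms(3) refl that] by (simp add: linear_add[OF assms(2)])
  then show ?thesis
    by (simp add: rho_r_def linear_add[OF assms(1)] sum.distrib)
qed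

lemma delta1_Cons:
  "delta1 bg mu rho01 \<omega> X (x # Z) =
     rho01 (mu x) (\<omega> X Z)
     - (\<Sum>k<length Z. (-1::real) ^ k *\<^sub>R rho01 (mu (Z ! k)) (\<omega> X (x # rem1 k Z)))
     - (\<Sum>b<length Z. (-1::real) ^ b *\<^sub>R \<omega> X (bg x (Z ! b) # rem1 b Z))
     + (\<Sum>b<length Z. \<Sum>a<b. (-1::real) ^ (a + b) *\<^sub>R \<omega> X (bg (Z ! a) (Z ! b) # x # rem2 a b Z))"
proof -
  have "(\<Sum>k<length (x # Z). (-1::real) ^ k *\<^sub>R rho01 (mu ((x # Z) ! k)) (\<omega> X (rem1 k (x # Z)))) =
     rho01 (mu x) (\<omega> X Z) - (\<Sum>k<length Z. (-1::real) ^ k *\<^sub>R rho01 (mu (Z ! k)) (\<omega> X (x # rem1 k Z)))"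
    by (simp add: sum.lessThan_Suc_shift sum_negf del: sum.lessThan_Suc)
  moreover have "(\<Sum>b<length (x # Z). \<Sum>a<b. (-1::real) ^ (a + b) *\<^sub>R
      \<omega> X (bg ((x # Z) ! a) ((x # Z) ! b) # rem2 a b (x # Z))) =
     - (\<Sum>b<length Z. (-1::real) ^ b *\<^sub>R \<omega> X (bg x (Z ! b) # rem1 b Z))
     + (\<Sum>b<length Z. \<Sum>a<b. (-1::real) ^ (a + b) *\<^sub>R \<omega> X (bg (Z ! a) (Z ! b) # x # rem2 a b Z))"
    by (simp add: sum.lessThan_Suc_shift sum.distrib sum_subtractf add.commute del: sum.lessThan_Suc)
  ultimately show ?thesis
    unfolding delta1_def by simp
qed

lemma delta1_Delta:
  assumes "\<And>y. linear (rho01 y)"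
  shows "delta1 bg mu rho01 (Delta mu \<omega>) \<Xi> Z =
    (\<Sum>j<length \<Xi>. (-1::real) ^ j *\<^sub>R
       delta1 bg mu rho01 (\<lambda>X Z'. \<omega> X (hd (fst (\<Xi> ! j)) # Z')) (map (face mu 0) (rem1 j \<Xi>)) Z)"
  by (simp add: delta1_def Delta_def linear_sum[OF assms] linear_cmul[OF assms] scaleR_right.sum
      scaleR_right_distrib sum.distrib sum.swap[of _ "{..<length \<Xi>}"] mult.commute)

lemma delta1_0_Delta_1:
  assumes "two_rep bg bh mu L phi rho01 rho00 rho1"
  shows "delta1_0 rho1 (Delta_1 mu phi \<omega>) \<Xi> [z] = delta1 bg mu rho01 (Delta mu \<omega>) \<Xi> [z]"
proof -
  from assms have "linear phi" "linear (rho1 z)" "rho01 (mu z) w = rho1 z (phi w)" for w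
    by (simp_all add: two_rep_def)
  then show ?thesis
    by (simp add: delta1_0_def delta1_def Delta_1_def Delta_def linear_sum linear_cmul)
qed

context
  fixes bg :: "'g::real_vector \<Rightarrow> 'g \<Rightarrow> 'g" and bh :: "'h::real_vector \<Rightarrow> 'h \<Rightarrow> 'h"
    and mu :: "'g \<Rightarrow> 'h" and L :: "'h \<Rightarrow> 'g \<Rightarrow> 'g"
  assumes cm: "crossed_module bg bh mu L"
begin

lemma crossed_module_lie_algebras: "lie_algebra bg" "lie_algebra bh"
  using cm by (simp_all add: crossed_module_def)

lemma crossed_module_linear_mu: "linear mu"
  using cm by (simp add: crossed_module_def lie_hom_def)

lemma crossed_module_mu_bracket: "mu (bg a b) = bh (mu a) (mu b)"
  using cm by (simp add: crossed_module_def lie_hom_def)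

lemma crossed_module_linear_action: "linear (\<lambda>y. L y x)" "linear (L y)"
  using cm by (simp_all add: crossed_module_def derivation_def)

lemma crossed_module_equivariant: "mu (L y x) = bh y (mu x)"
  using cm by (simp add: crossed_module_def)

lemma crossed_module_peiffer: "L (mu a) b = bg a b"
  using cm by (simp add: crossed_module_def)

text \<open>The target map (x, y) \<mapsto> y + \<mu> x of g \<oplus>_L h is a Lie algebra morphism.\<close>
lemma target_bracket:
  "bh (y + mu x) (y' + mu x') = bh y y' + mu (bg x x' + L y x' - L y' x)"
proof -
  note bh = crossed_module_lie_algebras(2)
  have "bh (y + mu x) (y' + mu x') = bh y y' + bh y (mu x') - bh y' (mu x) + bh (mu x) (mu x')"
    using lie_algebra_anticomm[OF bh, of "mu x" y']
    by (simp add: lie_algebra_add_left[OF bh] lie_algebra_add_right[OF bh])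
  then show ?thesis
    by (simp add: linear_add[OF crossed_module_linear_mu] linear_diff[OF crossed_module_linear_mu]
        crossed_module_mu_bracket crossed_module_equivariant)
qed

text \<open>Merging the composable arrows (a, t + \<mu> b) and (b, t) of g \<oplus>_L h into (a + b, t)
  is compatible with the bracket.\<close>
lemma bracket_compose:
  "bg (a + b) (a' + b') + L t (a' + b') - L t' (a + b) =
   (bg a a' + L (t + mu b) a' - L (t' + mu b') a) + (bg b b' + L t b' - L t' b)"
proof -
  note bg = crossed_module_lie_algebras(1)
  have "bg (a + b) (a' + b') = bg a a' + bg b a' - bg b' a + bg b b'"
    using lie_algebra_anticomm[OF bg, of a b']
    by (simp add: lie_algebra_add_left[OF bg] lie_algebra_add_right[OF bg])
  then show ?thesis
    by (simp add: linear_add[OF crossed_module_linear_action(1)] linear_add[OF crossed_module_linear_action(2)]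
        crossed_module_peiffer algebra_simps)
qed

lemma face_Suc_gp_bracket:
  assumes "length xs = length xs'" and "xs \<noteq> []"
  shows "face mu (Suc k) (gp_bracket bg bh mu L (xs, y) (xs', y')) =
         gp_bracket bg bh mu L (face mu (Suc k) (xs, y)) (face mu (Suc k) (xs', y'))"
  using assms
proof (induction xs xs' arbitrary: k rule: list_induct2)
  case (Cons x xs x' xs')
  consider (single) "xs = []" "xs' = []"
    | (longer) x2 xs2 x2' xs2' where "xs = x2 # xs2" "xs' = x2' # xs2'" "length xs2 = length xs2'"
    using Cons.hyps by (cases xs; cases xs') auto
  then show ?case
  proof cases
    case single
    then show ?thesis
      by (simp add: gp_bracket_Cons t_hat_def target_bracket)
  next
    case longer
    show ?thesis
    proof (cases k)
      case 0
      with longer show ?thesis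
        by (simp add: gp_bracket_Cons t_hat_Cons bracket_compose)
    next
      case (Suc k')
      let ?F = "face mu (Suc k') (xs, y)" and ?F' = "face mu (Suc k') (xs', y')"
      have "length (fst ?F) = length (fst ?F')"
        using longer by (simp add: length_face)
      moreover have "t_hat mu ?F = t_hat mu (xs, y)" "t_hat mu ?F' = t_hat mu (xs', y')"
        using longer by (simp_all add: t_hat_face crossed_module_linear_mu)
      moreover have "face mu (Suc k') (gp_bracket bg bh mu L (xs, y) (xs', y')) = gp_bracket bg bh mu L ?F ?F'"
        using Cons.IH longer by simp
      ultimately show ?thesis
        using longer Suc Cons.hyps by (simp add: gp_bracket_Cons)
    qed
  qed
qed simp

lemma face_gp_bracket:
  assumes "length (fst a) = Suc p" and "length (fst b) = Suc p"
  shows "face mu k (gp_bracket bg bh mu L a b) = gp_bracket bg bh mu L (face mu k a) (face mu k b)"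
proof -
  obtain x xs y x' xs' y' where a: "a = (x # xs, y)" and b: "b = (x' # xs', y')"
    using assms by (cases a; cases b) (auto simp: length_Suc_conv)
  show ?thesis
  proof (cases k)
    case 0
    with a b assms show ?thesis
      by (simp add: gp_bracket_Cons) (simp add: prod_eq_iff)
  next
    case (Suc k')
    with a b assms show ?thesis
      using face_Suc_gp_bracket[of "x # xs" "x' # xs'" k' y y'] by simp
  qed
qed

lemma delta_bracket_pd:
  assumes "\<forall>\<xi>\<in>set \<Xi>. length (fst \<xi>) = Suc p"
  shows "delta_bracket bg bh mu L (pd mu p \<omega>) \<Xi> Z = pd mu p (delta_bracket bg bh mu L \<omega>) \<Xi> Z"
proof -
  have "map (face mu k) (gp_bracket bg bh mu L (\<Xi> ! m) (\<Xi> ! n) # rem2 m n \<Xi>) =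
      gp_bracket bg bh mu L (map (face mu k) \<Xi> ! m) (map (face mu k) \<Xi> ! n) # rem2 m n (map (face mu k) \<Xi>)"
    if "m < n" "n < length \<Xi>" for k m n
    using that assms by (simp add: face_gp_bracket rem2_map)
  then show ?thesis
    unfolding delta_bracket_def pd_def
    by (simp add: scaleR_right.sum sum.swap[of _ "{..Suc p}"] mult.commute del: sum.atMost_Suc)
qed

lemma delta_action_pd:
  assumes lin: "\<And>y. linear (rho01 y)" "\<And>w. linear (\<lambda>y. rho01 y w)"
    and len: "\<forall>\<xi>\<in>set \<Xi>. length (fst \<xi>) = Suc p"
    and alt: "\<And>j. j < length \<Xi> \<Longrightarrow>
      alt_multilinear (\<lambda>_. True) (+) (*\<^sub>R) (length Z) (\<omega> (map (face mu 0) (rem1 j \<Xi>)))"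
  shows "delta_action mu L rho01 (pd mu p \<omega>) \<Xi> Z - pd mu p (delta_action mu L rho01 \<omega>) \<Xi> Z =
    (\<Sum>j<length \<Xi>. (-1::real) ^ j *\<^sub>R
       rho_r rho01 L (mu (hd (fst (\<Xi> ! j)))) (\<omega> (map (face mu 0) (rem1 j \<Xi>))) Z)"
proof -
  let ?R = "\<lambda>y j k. rho_r rho01 L y (\<omega> (map (face mu k) (rem1 j \<Xi>))) Z"
  have "delta_action mu L rho01 (pd mu p \<omega>) \<Xi> Z - pd mu p (delta_action mu L rho01 \<omega>) \<Xi> Z =
    (\<Sum>j<length \<Xi>. (-1::real) ^ j *\<^sub>R (\<Sum>k\<le>Suc p. (-1::real) ^ k *\<^sub>R
       (?R (t_hat mu (\<Xi> ! j)) j k - ?R (t_hat mu (face mu k (\<Xi> ! j))) j k)))"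
    by (simp add: delta_action_def rho_r_pd[OF lin(1)] pd_def rem1_map scaleR_right.sum
        scaleR_right_diff_distrib sum_subtractf sum.swap[of _ "{..Suc p}"] mult.commute del: sum.atMost_Suc)
  also have "\<dots> = (\<Sum>j<length \<Xi>. (-1::real) ^ j *\<^sub>R ?R (mu (hd (fst (\<Xi> ! j)))) j 0)"
  proof (intro sum.cong refl)
    fix j
    assume "j \<in> {..<length \<Xi>}"
    then have j: "j < length \<Xi>"
      by simp
    then have "length (fst (\<Xi> ! j)) = Suc p"
      using len by simp
    then obtain x xs y where \<xi>: "\<Xi> ! j = (x # xs, y)"
      by (cases "\<Xi> ! j") (auto simp: length_Suc_conv)
    have "?R (t_hat mu (\<Xi> ! j)) j 0 - ?R (t_hat mu (face mu 0 (\<Xi> ! j))) j 0 = ?R (mu x) j 0"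
      using rho_r_add[OF lin(2) crossed_module_linear_action(1) alt[OF j]]
      by (simp add: \<xi> t_hat_Cons)
    moreover have "t_hat mu (face mu (Suc k) (\<Xi> ! j)) = t_hat mu (\<Xi> ! j)" for k
      using t_hat_face[OF crossed_module_linear_mu] by (simp add: \<xi>)
    ultimately show "(-1::real) ^ j *\<^sub>R (\<Sum>k\<le>Suc p. (-1::real) ^ k *\<^sub>R
       (?R (t_hat mu (\<Xi> ! j)) j k - ?R (t_hat mu (face mu k (\<Xi> ! j))) j k)) =
       (-1::real) ^ j *\<^sub>R ?R (mu (hd (fst (\<Xi> ! j)))) j 0"
      by (simp only: sum.atMost_Suc_shift) (simp add: \<xi>)
  qed
  finally show ?thesis .
qed

lemma rho_r_mu_cartan:
  assumes alt: "alt_multilinear (\<lambda>_. True) (+) (*\<^sub>R) (length Z) (\<omega> X)"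
  shows "rho_r rho01 L (mu x) (\<omega> X) Z =
    delta1 bg mu rho01 (\<lambda>X' Z'. \<omega> X' (x # Z')) X Z + delta1 bg mu rho01 \<omega> X (x # Z)"
proof -
  have move: "\<omega> X (Z[k := bg x (Z ! k)]) = (-1::real) ^ k *\<^sub>R \<omega> X (bg x (Z ! k) # rem1 k Z)"
    if "k < length Z" for k
    using alt_multilinear_move_to_front[OF alt, of "take k Z" "bg x (Z ! k)" "drop (Suc k) Z"] that
    by (simp add: upd_conv_take_nth_drop rem1_def min_def)
  have swap: "\<omega> X (bg (Z ! a) (Z ! b) # x # rem2 a b Z) = - \<omega> X (x # bg (Z ! a) (Z ! b) # rem2 a b Z)"
    if "a < b" "b < length Z" for a b
    using alt_multilinear_swap[OF alt, of "[]" "bg (Z ! a) (Z ! b)" x "rem2 a b Z"] that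
    by (simp add: length_rem2)
  show ?thesis
    unfolding delta1_Cons
    by (simp add: rho_r_def delta1_def crossed_module_peiffer move swap sum_negf)
qed

end

theorem mainTheorem10:
  fixes bg :: "'g::real_vector \<Rightarrow> 'g \<Rightarrow> 'g" and bh :: "'h::real_vector \<Rightarrow> 'h \<Rightarrow> 'h"
    and mu :: "'g \<Rightarrow> 'h" and L :: "'h \<Rightarrow> 'g \<Rightarrow> 'g"
    and phi :: "'w::real_vector \<Rightarrow> 'v::real_vector"
    and rho01 :: "'h \<Rightarrow> 'w \<Rightarrow> 'w" and rho00 :: "'h \<Rightarrow> 'v \<Rightarrow> 'v" and rho1 :: "'g \<Rightarrow> 'v \<Rightarrow> 'w"
    and \<omega> :: "('g list \<times> 'h) list \<Rightarrow> 'g list \<Rightarrow> 'w"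
    and p q r :: nat and \<Xi> :: "('g list \<times> 'h) list" and Z :: "'g list"
  assumes "crossed_module bg bh mu L"
    and "two_rep bg bh mu L phi rho01 rho00 rho1"
    and "1 \<le> r"
    and "cochain p q r \<omega>"
    and "length \<Xi> = Suc q" and "\<forall>\<xi>\<in>set \<Xi>. length (fst \<xi>) = Suc p"
    and "length Z = r"
  shows "delta_r bg bh mu L rho01 (pd mu p \<omega>) \<Xi> Z - pd mu p (delta_r bg bh mu L rho01 \<omega>) \<Xi> Z =
         (if r = 1 then delta1_0 rho1 (Delta_1 mu phi \<omega>) \<Xi> Z
          else delta1 bg mu rho01 (Delta mu \<omega>) \<Xi> Z)
         + Delta mu (delta1 bg mu rho01 \<omega>) \<Xi> Z"
proof -
  have lin: "linear (rho01 y)" "linear (\<lambda>y. rho01 y w)" for y w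
    using assms(2) by (simp_all add: two_rep_def representation_def)
  have alt: "alt_multilinear (\<lambda>_. True) (+) (*\<^sub>R) (length Z) (\<omega> (map (face mu 0) (rem1 j \<Xi>)))"
    if "j < length \<Xi>" for j
    using cochain_alt_multilinear_face_rem1[OF assms(4-6) that] assms(7) by simp
  have "delta_r bg bh mu L rho01 (pd mu p \<omega>) \<Xi> Z - pd mu p (delta_r bg bh mu L rho01 \<omega>) \<Xi> Z =
      (delta_action mu L rho01 (pd mu p \<omega>) \<Xi> Z - pd mu p (delta_action mu L rho01 \<omega>) \<Xi> Z) +
      (delta_bracket bg bh mu L (pd mu p \<omega>) \<Xi> Z - pd mu p (delta_bracket bg bh mu L \<omega>) \<Xi> Z)"
    by (simp add: delta_r_eq_action_plus_bracket pd_add)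
  also have "\<dots> = (\<Sum>j<length \<Xi>. (-1::real) ^ j *\<^sub>R
       rho_r rho01 L (mu (hd (fst (\<Xi> ! j)))) (\<omega> (map (face mu 0) (rem1 j \<Xi>))) Z)"
    using delta_action_pd[OF assms(1) lin assms(6), where \<omega>=\<omega>, OF alt] delta_bracket_pd[OF assms(1,6)]
    by simp
  also have "\<dots> = delta1 bg mu rho01 (Delta mu \<omega>) \<Xi> Z + Delta mu (delta1 bg mu rho01 \<omega>) \<Xi> Z"
    by (simp add: rho_r_mu_cartan[OF assms(1), where \<omega>=\<omega>, OF alt] delta1_Delta[OF lin(1)] Delta_def
        scaleR_right_distrib sum.distrib)
  also have "delta1 bg mu rho01 (Delta mu \<omega>) \<Xi> Z =
      (if r = 1 then delta1_0 rho1 (Delta_1 mu phi \<omega>) \<Xi> Z else delta1 bg mu rho01 (Delta mu \<omega>) \<Xi> Z)"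
  proof (cases "r = 1")
    case True
    then obtain z where "Z = [z]"
      using assms(7) by (cases Z) auto
    with True show ?thesis
      using delta1_0_Delta_1[OF assms(2)] by simp
  qed simp
  finally show ?thesis .
qed

end
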